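(* For any $\beta_1>0$, $\beta_2>0$, $\nu>0$, and parameters $\mu_1,\mu_2\in\mathbb{C}$ the following relations hold (as functions of $t>0$): (i) $$(I-\mu_2J^{\beta_2})^{-1}\Big[t^{\nu-1}E_{\beta_1,\nu}(\mu_1t^{\beta_1})-\mu_1J^\nu\big(t^{\beta_1-1}E_{\beta_1,\beta_1}(\mu_1t^{\beta_1})\big)\Big]=t^{\nu-1}E_{\beta_2,\nu}(\mu_2t^{\beta_2});$$ (ii) $$(I-\mu_2J^{\beta_2})^{-1}J^{\beta_2}\big[t^{\nu-1}E_{\beta_1,\nu}(\mu_1t^{\beta_1})\big]=\big(t^{\nu-1}E_{\beta_1,\nu}(\mu_1t^{\beta_1})\big)*\big(t^{\beta_2-1}E_{\beta_2,\beta_2}(\mu_2t^{\beta_2})\big),$$ where $*$ is the convolution operation.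
   Context: $J^\gamma f(t)=\frac1{\Gamma(\gamma)}\int_0^t(t-\tau)^{\gamma-1}f(\tau)\,d\tau$ for $\gamma>0$; $I$ is the identity operator; $(I-\mu J^\beta)^{-1}=\sum_{k=0}^\infty\mu^kJ^{k\beta}$ is the inverse of $I-\mu J^\beta$. $E_{\beta,\nu}(z)=\sum_{n=0}^\infty\frac{z^n}{\Gamma(\beta n+\nu)}$ is the two-parameter Mittag-Leffler function. The convolution is $(f*g)(t)=\int_0^tf(\tau)g(t-\tau)\,d\tau$. *)

theory Defs
  imports "HOL-Analysis.Analysis"
begin

text \<open>
  All functions below are functions of \<open>t > 0\<close>, represented as total functions on
  \<^typ>\<open>real\<close>; the integrals over \<open>{0..t}\<close> are Lebesgue integrals and so do not depend
  on the value at \<open>0\<close>.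
\<close>

definition RL_integrand :: "real \<Rightarrow> (real \<Rightarrow> complex) \<Rightarrow> real \<Rightarrow> real \<Rightarrow> complex" where
  "RL_integrand \<gamma> f t \<tau> = complex_of_real ((t - \<tau>) powr (\<gamma> - 1)) * f \<tau>"

text \<open>
  The fractional integral \<open>J\<^sup>\<gamma> f (t)\<close>. The case \<open>\<gamma> = 0\<close> is the convention
  \<open>J\<^sup>0 = I\<close>, which is what the term \<open>k = 0\<close> of the series for
  \<open>(I - \<mu> J\<^sup>\<beta>)\<^sup>-\<^sup>1\<close> stands for; only \<open>\<gamma> \<ge> 0\<close> is meaningful.
\<close>

definition RL_integral :: "real \<Rightarrow> (real \<Rightarrow> complex) \<Rightarrow> real \<Rightarrow> complex" where
  "RL_integral \<gamma> f t =
     (if \<gamma> = 0 then f t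
      else complex_of_real (1 / Gamma \<gamma>) * (LBINT \<tau>:{0..t}. RL_integrand \<gamma> f t \<tau>))"

definition RL_integrable :: "real \<Rightarrow> (real \<Rightarrow> complex) \<Rightarrow> real \<Rightarrow> bool" where
  "RL_integrable \<gamma> f t \<longleftrightarrow> \<gamma> = 0 \<or> set_integrable lborel {0..t} (RL_integrand \<gamma> f t)"

text \<open>
  \<open>(I - \<mu> J\<^sup>\<beta>)\<^sup>-\<^sup>1\<close>, given by the pointwise Neumann series. The predicate says that
  all fractional integrals in the series exist at \<open>t\<close> and that the series converges there.
\<close>

definition RL_resolvent :: "complex \<Rightarrow> real \<Rightarrow> (real \<Rightarrow> complex) \<Rightarrow> real \<Rightarrow> complex" where
  "RL_resolvent \<mu> \<beta> f t = (\<Sum>k. \<mu> ^ k * RL_integral (real k * \<beta>) f t)"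

definition RL_resolvent_exists :: "complex \<Rightarrow> real \<Rightarrow> (real \<Rightarrow> complex) \<Rightarrow> real \<Rightarrow> bool" where
  "RL_resolvent_exists \<mu> \<beta> f t \<longleftrightarrow>
     (\<forall>k. RL_integrable (real k * \<beta>) f t) \<and>
     summable (\<lambda>k. \<mu> ^ k * RL_integral (real k * \<beta>) f t)"

definition Mittag_Leffler :: "real \<Rightarrow> real \<Rightarrow> complex \<Rightarrow> complex" where
  "Mittag_Leffler \<beta> \<nu> z = (\<Sum>n. z ^ n / complex_of_real (Gamma (\<beta> * real n + \<nu>)))"

text \<open>The function \<open>t\<^sup>\<nu>\<^sup>-\<^sup>1 E\<^sub>\<beta>\<^sub>,\<^sub>\<nu>(\<mu> t\<^sup>\<beta>)\<close>.\<close>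

definition Mittag_Leffler_fun :: "real \<Rightarrow> real \<Rightarrow> complex \<Rightarrow> real \<Rightarrow> complex" where
  "Mittag_Leffler_fun \<beta> \<nu> \<mu> t =
     complex_of_real (t powr (\<nu> - 1)) * Mittag_Leffler \<beta> \<nu> (\<mu> * complex_of_real (t powr \<beta>))"

definition convolution :: "(real \<Rightarrow> complex) \<Rightarrow> (real \<Rightarrow> complex) \<Rightarrow> real \<Rightarrow> complex" where
  "convolution f g t = (LBINT \<tau>:{0..t}. f \<tau> * g (t - \<tau>))"

definition convolution_exists :: "(real \<Rightarrow> complex) \<Rightarrow> (real \<Rightarrow> complex) \<Rightarrow> real \<Rightarrow> bool" where
  "convolution_exists f g t \<longleftrightarrow> set_integrable lborel {0..t} (\<lambda>\<tau>. f \<tau> * g (t - \<tau>))"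

end

theory Submission
  imports Defs
begin

text \<open>
  The statement is an identity between power series in the kernels
  \<open>h\<^sub>a(t) = t\<^sup>a\<^sup>-\<^sup>1 / \<Gamma>(a)\<close> (\<open>power_kernel\<close>). Three facts about them are used. The Beta integral
  says \<open>J\<^sup>b h\<^sub>a = h\<^sub>a\<^sub>+\<^sub>b\<close> (\<open>RL_integral_power_kernel\<close>); the operator \<open>J\<^sup>b\<close> is convolution with \<open>h\<^sub>b\<close>
  (\<open>RL_integral_eq_convolution\<close>); and \<open>t\<^sup>\<nu>\<^sup>-\<^sup>1 E\<^sub>\<beta>\<^sub>,\<^sub>\<nu>(\<mu> t\<^sup>\<beta>)\<close>, written \<open>M(\<beta>, \<nu>, \<mu>)\<close> here, is the
  absolutely convergent series of \<open>\<mu>\<^sup>n h(\<beta>n + \<nu>)\<close> (\<open>Mittag_Leffler_fun_series\<close>).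

  The main analytic step is to integrate that last series term by term against a function \<open>f\<close>
  that is at most of size \<open>\<tau>\<^sup>a\<^sup>-\<^sup>1\<close>, which gives
  \<open>f * M(\<beta>, \<nu>, \<mu>) = \<Sum>k. \<mu>\<^sup>k J(\<beta>k + \<nu>) f\<close> (\<open>convolution_Mittag_Leffler_fun\<close>). With \<open>f = h\<^sub>\<gamma>\<close> it
  becomes \<open>J\<^sup>\<gamma> M(\<beta>, \<nu>, \<mu>) = M(\<beta>, \<nu> + \<gamma>, \<mu>)\<close> (\<open>RL_integral_Mittag_Leffler_fun\<close>).

  For (i), the bracket is therefore \<open>M(\<beta>\<^sub>1, \<nu>, \<mu>\<^sub>1) - \<mu>\<^sub>1 M(\<beta>\<^sub>1, \<nu> + \<beta>\<^sub>1, \<mu>\<^sub>1)\<close>, which telescopes to the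
  first term \<open>h\<^sub>\<nu>\<close> of the series; it no longer depends on \<open>\<beta>\<^sub>1\<close> and \<open>\<mu>\<^sub>1\<close>, and its Neumann series is the series
  of \<open>M(\<beta>\<^sub>2, \<nu>, \<mu>\<^sub>2)\<close>. For (ii), the shift rule yields \<open>J(k\<beta>\<^sub>2) J(\<beta>\<^sub>2) f = J(k\<beta>\<^sub>2 + \<beta>\<^sub>2) f\<close> for
  \<open>f = M(\<beta>\<^sub>1, \<nu>, \<mu>\<^sub>1)\<close>, so the Neumann series is the termwise integrated convolution of \<open>f\<close> with
  \<open>M(\<beta>\<^sub>2, \<beta>\<^sub>2, \<mu>\<^sub>2)\<close>.
\<close>

section \<open>Power kernels and their fractional integrals\<close>

text \<open>
  The normalisation by \<open>\<Gamma>(a)\<close> makes the kernels a convolution semigroup in \<open>a\<close>. Since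
  \<open>0 powr x = 0\<close> for every \<open>x\<close>, each kernel vanishes at \<open>t = 0\<close>, and so does
  \<^const>\<open>Mittag_Leffler_fun\<close>; this is why many identities below extend to \<open>t = 0\<close>.
\<close>

definition power_kernel :: "real \<Rightarrow> real \<Rightarrow> complex" where
  "power_kernel a t = complex_of_real (t powr (a - 1) / Gamma a)"

text \<open>
  Substituting \<open>\<tau> = t u\<close> turns this into the Beta integral over \<open>{0..1}\<close>.
\<close>

lemma Beta_integral_scaled:
  fixes a b t :: real
  assumes a: "a > 0" and b: "b > 0" and t: "t > 0"
  shows "has_bochner_integral lborel
           (\<lambda>\<tau>. indicator {0..t} \<tau> *\<^sub>R (\<tau> powr (a - 1) * (t - \<tau>) powr (b - 1)))
           (t powr (a + b - 1) * Beta a b)"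
proof -
  let ?F = "\<lambda>u::real. indicator {0..1} u *\<^sub>R (u powr (a - 1) * (1 - u) powr (b - 1))"
  let ?G = "\<lambda>\<tau>. indicator {0..t} \<tau> *\<^sub>R (\<tau> powr (a - 1) * (t - \<tau>) powr (b - 1))"
  have int: "set_integrable lborel {0..1} (\<lambda>u::real. u powr (a - 1) * (1 - u) powr (b - 1))"
    using integrable_Beta[OF a b] .
  have "(LBINT u:{0..1}. u powr (a - 1) * (1 - u) powr (b - 1)) = Beta a b"
    using set_borel_integral_eq_integral(2)[OF int] integral_unique[OF has_integral_Beta_real[OF a b]]
    by simp
  with int have "has_bochner_integral lborel ?F (Beta a b)"
    by (simp add: has_bochner_integral_iff set_integrable_def set_lebesgue_integral_def)
  then have "has_bochner_integral lborel (\<lambda>u. t powr (a + b - 2) * ?F u) (t powr (a + b - 2) * Beta a b)"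
    by (intro has_bochner_integral_mult_right) simp
  moreover have "t powr (a + b - 2) * ?F u = ?G (0 + t * u)" for u
  proof (cases "u \<in> {0..1}")
    case True
    have "(t * u) powr (a - 1) * (t - t * u) powr (b - 1)
          = (t powr (a - 1) * t powr (b - 1)) * (u powr (a - 1) * (1 - u) powr (b - 1))"
      using True t powr_mult[of t "1 - u" "b - 1"] by (simp add: powr_mult algebra_simps)
    then show ?thesis
      using True t by (simp add: powr_add[symmetric] algebra_simps)
  next
    case False
    with t have "t * u \<notin> {0..t}"
      by (auto simp: zero_le_mult_iff mult_le_cancel_left1)
    with False show ?thesis by simp
  qed
  moreover have "t powr (a + b - 2) * Beta a b = (t powr (a + b - 1) * Beta a b) /\<^sub>R \<bar>t\<bar>"
    using t powr_add[of t "a + b - 2" 1] by (simp add: field_simps)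
  ultimately show ?thesis
    using lborel_has_bochner_integral_real_affine_iff[of t ?G "t powr (a + b - 1) * Beta a b" 0] t
    by simp
qed

text \<open>
  The Beta integral in operator form, using \<open>B(a, b) = \<Gamma>(a) \<Gamma>(b) / \<Gamma>(a + b)\<close>.
\<close>

lemma RL_integral_power_kernel:
  assumes a: "a > 0" and b: "b \<ge> 0" and t: "t > 0"
  shows "RL_integrable b (power_kernel a) t"
    and "RL_integral b (power_kernel a) t = power_kernel (a + b) t"
proof -
  have *: "has_bochner_integral lborel (\<lambda>\<tau>. indicator {0..t} \<tau> *\<^sub>R RL_integrand b (power_kernel a) t \<tau>)
       (complex_of_real (t powr (a + b - 1) * Beta a b / Gamma a))" if "b > 0"
  proof -
    have "has_bochner_integral lborel
      (\<lambda>\<tau>. complex_of_real ((indicator {0..t} \<tau> *\<^sub>R (\<tau> powr (a - 1) * (t - \<tau>) powr (b - 1))) / Gamma a))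
      (complex_of_real (t powr (a + b - 1) * Beta a b / Gamma a))"
      using Beta_integral_scaled[OF a that t]
      by (intro has_bochner_integral_of_real has_bochner_integral_divide_zero) auto
    moreover have "complex_of_real ((indicator {0..t} \<tau> *\<^sub>R (\<tau> powr (a - 1) * (t - \<tau>) powr (b - 1))) / Gamma a)
      = indicator {0..t} \<tau> *\<^sub>R RL_integrand b (power_kernel a) t \<tau>" for \<tau>
      by (simp add: RL_integrand_def power_kernel_def indicator_def)
    ultimately show ?thesis by simp
  qed
  show "RL_integrable b (power_kernel a) t"
    using * b by (auto simp: RL_integrable_def set_integrable_def has_bochner_integral_iff less_le)
  show "RL_integral b (power_kernel a) t = power_kernel (a + b) t"
  proof (cases "b = 0")
    case False
    then have "b > 0" using b by simp
    from has_bochner_integral_integral_eq[OF *[OF this]] a \<open>b > 0\<close> show ?thesis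
      by (simp add: RL_integral_def set_lebesgue_integral_def power_kernel_def Beta_def
          less_imp_neq[THEN not_sym] Gamma_real_pos[THEN less_imp_neq, THEN not_sym])
  qed (simp add: RL_integral_def)
qed

section \<open>Convergence of the Mittag-Leffler series\<close>

text \<open>
  On \<open>[R, R + 1]\<close> the integrand \<open>t\<^sup>x\<^sup>-\<^sup>1 e\<^sup>-\<^sup>t\<close> of \<open>\<Gamma>(x)\<close> is at least the left-hand side. As \<open>R\<close> is
  arbitrary, \<open>\<Gamma>\<close> outgrows every exponential.
\<close>

lemma Gamma_lower_bound:
  fixes x R :: real
  assumes x: "x \<ge> 1" and R: "R > 0"
  shows "R powr (x - 1) * exp (- (R + 1)) \<le> Gamma x"
proof (rule has_integral_le)
  let ?c = "R powr (x - 1) * exp (- (R + 1))"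
  have "((\<lambda>_. ?c) has_integral ?c) {R..R+1}"
    using has_integral_const_real[of ?c R "R + 1"] by simp
  then show "((\<lambda>t. if t \<in> {R..R+1} then ?c else 0) has_integral ?c) {0..}"
    using R by (subst has_integral_restrict) auto
  show "((\<lambda>t. t powr (x - 1) / exp t) has_integral Gamma x) {0..}"
    by (rule Gamma_integral_real) (use x in simp)
  fix t :: real
  assume "t \<in> {0..}"
  show "(if t \<in> {R..R+1} then ?c else 0) \<le> t powr (x - 1) / exp t"
  proof (cases "t \<in> {R..R+1}")
    case True
    with x R have "R powr (x - 1) * exp (- (R + 1)) \<le> t powr (x - 1) * exp (- t)"
      by (intro mult_mono powr_mono2) auto
    with True show ?thesis by (simp add: exp_minus divide_inverse)
  qed auto
qed

text \<open>
  Choosing \<open>R\<close> in the lower bound for \<open>\<Gamma>\<close> such that \<open>R\<^sup>\<beta> > 2 |z|\<close> compares the series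
  with a geometric one of ratio \<open>1/2\<close>.
\<close>

lemma summable_Mittag_Leffler:
  fixes \<beta> \<nu> :: real and z :: complex
  assumes \<beta>: "\<beta> > 0" and \<nu>: "\<nu> > 0"
  shows "summable (\<lambda>n. norm (z ^ n / complex_of_real (Gamma (\<beta> * real n + \<nu>))))"
proof -
  \<comment> \<open>The summand \<open>1\<close> keeps \<open>R\<close> positive when \<open>z = 0\<close>.\<close>
  define R where "R = (2 * norm z + 1) powr (1 / \<beta>)"
  have R: "R > 0" by (simp add: R_def add_nonneg_eq_0_iff)
  have Rb: "R powr \<beta> = 2 * norm z + 1"
    using \<beta> by (simp add: R_def powr_powr)
  define C where "C = exp (R + 1) / R powr (\<nu> - 1)"
  have le: "norm (z ^ n / complex_of_real (Gamma (\<beta> * real n + \<nu>))) \<le> C * (1/2) ^ n"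
    \<comment> \<open>Large \<open>n\<close> only: the lower bound for \<open>\<Gamma>\<close> needs an argument of at least \<open>1\<close>.\<close>
    if n: "n \<ge> nat \<lceil>1 / \<beta>\<rceil>" for n
  proof -
    have "1 / \<beta> \<le> real n" using n by linarith
    then have "1 \<le> \<beta> * real n + \<nu>" using \<beta> \<nu> by (simp add: field_simps)
    from Gamma_lower_bound[OF this R]
    have G: "R powr (\<beta> * real n + \<nu> - 1) * exp (- (R + 1)) \<le> Gamma (\<beta> * real n + \<nu>)" .
    have "R powr (\<beta> * real n + \<nu> - 1) = (R powr \<beta>) powr real n * R powr (\<nu> - 1)"
      using R by (simp add: powr_powr powr_add[symmetric] algebra_simps)
    also have "(R powr \<beta>) powr real n = (2 * norm z + 1) ^ n"
      by (subst powr_realpow) (auto simp: Rb add_nonneg_pos)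
    finally have eq: "R powr (\<beta> * real n + \<nu> - 1) * exp (- (R + 1)) = (2 * norm z + 1) ^ n / C"
      unfolding exp_minus[of "R + 1"] using R by (simp add: C_def divide_inverse)
    have C: "C > 0" using R by (simp add: C_def)
    have "(2 * norm z) ^ n \<le> (2 * norm z + 1) ^ n"
      by (intro power_mono) auto
    also have "\<dots> \<le> C * Gamma (\<beta> * real n + \<nu>)"
      using G C unfolding eq by (simp add: field_simps)
    finally have "2 ^ n * norm z ^ n \<le> C * Gamma (\<beta> * real n + \<nu>)"
      by (simp add: power_mult_distrib)
    moreover have "Gamma (\<beta> * real n + \<nu>) > 0"
      using \<beta> \<nu> by (intro Gamma_real_pos add_nonneg_pos) auto
    ultimately show ?thesis
      by (simp add: norm_divide norm_power field_simps)
  qed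
  have "summable (\<lambda>n. C * (1/2::real) ^ n)"
    by (intro summable_mult summable_geometric) simp
  then show ?thesis
    by (rule summable_comparison_test'[where N = "nat \<lceil>1 / \<beta>\<rceil>"]) (use le in simp)
qed

text \<open>
  The factors \<open>t\<^sup>\<nu>\<^sup>-\<^sup>1\<close> and \<open>(t\<^sup>\<beta>)\<^sup>n\<close> combine into the power in \<open>h(\<beta>n + \<nu>)\<close>.
\<close>

lemma Mittag_Leffler_fun_series:
  assumes \<beta>: "\<beta> > 0" and \<nu>: "\<nu> > 0" and t: "t \<ge> 0"
  shows "summable (\<lambda>n. norm (\<mu> ^ n * power_kernel (\<beta> * real n + \<nu>) t))"
    and "(\<lambda>n. \<mu> ^ n * power_kernel (\<beta> * real n + \<nu>) t) sums Mittag_Leffler_fun \<beta> \<nu> \<mu> t"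
proof -
  let ?a = "\<lambda>n. (\<mu> * complex_of_real (t powr \<beta>)) ^ n / complex_of_real (Gamma (\<beta> * real n + \<nu>))"
  have eq: "\<mu> ^ n * power_kernel (\<beta> * real n + \<nu>) t = complex_of_real (t powr (\<nu> - 1)) * ?a n" for n
  proof (cases "t = 0")
    case False
    with t have "t powr (\<beta> * real n + \<nu> - 1) = t powr (\<nu> - 1) * (t powr \<beta>) ^ n"
      by (simp add: powr_powr powr_add[symmetric] powr_realpow[symmetric] algebra_simps)
    then show ?thesis by (simp add: power_kernel_def power_mult_distrib)
  qed (simp add: power_kernel_def)
  have a: "summable (\<lambda>n. norm (?a n))"
    by (rule summable_Mittag_Leffler[OF \<beta> \<nu>])
  then show "summable (\<lambda>n. norm (\<mu> ^ n * power_kernel (\<beta> * real n + \<nu>) t))"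
    unfolding eq norm_mult by (rule summable_mult)
  show "(\<lambda>n. \<mu> ^ n * power_kernel (\<beta> * real n + \<nu>) t) sums Mittag_Leffler_fun \<beta> \<nu> \<mu> t"
    unfolding eq Mittag_Leffler_fun_def Mittag_Leffler_def
    by (intro sums_mult summable_sums summable_norm_cancel[OF a])
qed

text \<open>
  The power series \<open>\<Sum>n. |\<mu>|\<^sup>n \<tau>\<^sup>\<beta>\<^sup>n / \<Gamma>(\<beta>n + \<nu>)\<close> is increasing in \<open>\<tau>\<close>, so its value at \<open>t\<close> can serve
  as \<open>C\<close>. This qualifies \<open>M(\<beta>, \<nu>, \<mu>)\<close> as the factor \<open>f\<close> of the termwise integration below.
\<close>

lemma Mittag_Leffler_fun_bound:
  assumes \<beta>: "\<beta> > 0" and \<nu>: "\<nu> > 0"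
  shows "\<exists>C. \<forall>\<tau>\<in>{0..t}. norm (Mittag_Leffler_fun \<beta> \<nu> \<mu> \<tau>) \<le> C * \<tau> powr (\<nu> - 1)"
proof (intro exI ballI)
  let ?b = "\<lambda>\<tau> n. norm ((\<mu> * complex_of_real (\<tau> powr \<beta>)) ^ n / complex_of_real (Gamma (\<beta> * real n + \<nu>)))"
  have b: "summable (?b \<tau>)" for \<tau>
    by (rule summable_Mittag_Leffler[OF \<beta> \<nu>])
  fix \<tau> assume \<tau>: "\<tau> \<in> {0..t}"
  have "norm (Mittag_Leffler \<beta> \<nu> (\<mu> * complex_of_real (\<tau> powr \<beta>))) \<le> suminf (?b \<tau>)"
    unfolding Mittag_Leffler_def by (rule summable_norm[OF b])
  also have "\<dots> \<le> suminf (?b t)"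
    using \<tau> \<beta> by (intro suminf_le b)
      (auto simp: norm_divide norm_power norm_mult
            intro!: divide_right_mono power_mono mult_left_mono powr_mono2)
  finally show "norm (Mittag_Leffler_fun \<beta> \<nu> \<mu> \<tau>) \<le> suminf (?b t) * \<tau> powr (\<nu> - 1)"
    by (simp add: Mittag_Leffler_fun_def norm_mult mult.commute mult_left_mono)
qed

lemma borel_measurable_power_kernel [measurable]: "power_kernel a \<in> borel_measurable borel"
  unfolding power_kernel_def[abs_def] by measurable

lemma borel_measurable_Mittag_Leffler_fun [measurable]:
  "Mittag_Leffler_fun \<beta> \<nu> \<mu> \<in> borel_measurable borel"
  unfolding Mittag_Leffler_fun_def[abs_def] Mittag_Leffler_def by measurable

section \<open>Convolution with a Mittag-Leffler function\<close>

lemma RL_integral_eq_convolution: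
  assumes "\<gamma> > 0"
  shows "RL_integrable \<gamma> f t \<longleftrightarrow> convolution_exists f (power_kernel \<gamma>) t"
    and "RL_integral \<gamma> f t = convolution f (power_kernel \<gamma>) t"
proof -
  have G: "Gamma \<gamma> \<noteq> 0" using Gamma_real_pos[OF assms] by simp
  have eq: "(\<lambda>\<tau>. f \<tau> * power_kernel \<gamma> (t - \<tau>))
      = (\<lambda>\<tau>. complex_of_real (1 / Gamma \<gamma>) * RL_integrand \<gamma> f t \<tau>)"
    by (simp add: fun_eq_iff power_kernel_def RL_integrand_def)
  show "RL_integrable \<gamma> f t \<longleftrightarrow> convolution_exists f (power_kernel \<gamma>) t"
    unfolding convolution_exists_def eq using assms G by (simp add: RL_integrable_def)
  show "RL_integral \<gamma> f t = convolution f (power_kernel \<gamma>) t"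
    unfolding convolution_def eq using assms by (simp add: RL_integral_def)
qed

text \<open>
  The reflection \<open>\<tau> \<mapsto> t - \<tau>\<close> preserves both \<open>{0..t}\<close> and Lebesgue measure.
\<close>

lemma convolution_commute:
  shows "convolution_exists f g t \<longleftrightarrow> convolution_exists g f t"
    and "convolution f g t = convolution g f t"
proof -
  let ?F = "\<lambda>\<tau>. indicator {0..t} \<tau> *\<^sub>R (f \<tau> * g (t - \<tau>))"
  have eq: "?F (t + - 1 * \<tau>) = indicator {0..t} \<tau> *\<^sub>R (g \<tau> * f (t - \<tau>))" for \<tau>
    by (auto simp: indicator_def)
  show "convolution_exists f g t \<longleftrightarrow> convolution_exists g f t"
    using lborel_integrable_real_affine_iff[of "-1" ?F t]
    unfolding eq convolution_exists_def set_integrable_def by simp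
  show "convolution f g t = convolution g f t"
    using lborel_integral_real_affine[of "-1" ?F t]
    unfolding eq convolution_def set_lebesgue_integral_def by simp
qed

text \<open>
  Dominating \<open>f\<close> by \<open>C \<Gamma>(a) h\<^sub>a\<close> and using \<open>h\<^sub>a * h\<^sub>b = h\<^sub>a\<^sub>+\<^sub>b\<close> bounds the absolute integral; the
  point is that the constant \<open>C \<Gamma>(a)\<close> does not depend on \<open>b\<close>.
\<close>

lemma convolution_power_kernel_bound:
  assumes f [measurable]: "f \<in> borel_measurable borel"
    and bound: "\<And>\<tau>. \<tau> \<in> {0..t} \<Longrightarrow> norm (f \<tau>) \<le> C * \<tau> powr (a - 1)"
    and a: "a > 0" and b: "b > 0" and t: "t > 0"
  shows "convolution_exists f (power_kernel b) t"
    and "(\<integral>\<tau>. norm (indicator {0..t} \<tau> *\<^sub>R (f \<tau> * power_kernel b (t - \<tau>))) \<partial>lborel)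
           \<le> C * Gamma a * norm (power_kernel (a + b) t)"
proof -
  let ?F = "\<lambda>\<tau>. indicator {0..t} \<tau> *\<^sub>R (f \<tau> * power_kernel b (t - \<tau>))"
  let ?G = "\<lambda>\<tau>. C / Gamma b * (indicator {0..t} \<tau> *\<^sub>R (\<tau> powr (a - 1) * (t - \<tau>) powr (b - 1)))"
  have G: "Gamma a > 0" "Gamma b > 0" "Gamma (a + b) > 0"
    using a b by (auto intro: Gamma_real_pos)
  have dom: "norm (?F \<tau>) \<le> ?G \<tau>" for \<tau>
  proof (cases "\<tau> \<in> {0..t}")
    case True
    then show ?thesis
      using mult_right_mono[OF bound[OF True], of "norm (power_kernel b (t - \<tau>))"] G
      by (simp add: norm_mult power_kernel_def norm_divide mult_ac)
  qed simp
  have int: "has_bochner_integral lborel ?G (C / Gamma b * (t powr (a + b - 1) * Beta a b))"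
    using Beta_integral_scaled[OF a b t] by (intro has_bochner_integral_mult_right) simp
  have F: "integrable lborel ?F"
  proof (rule Bochner_Integration.integrable_bound)
    show "integrable lborel ?G" using int by (simp add: has_bochner_integral_iff)
    show "AE \<tau> in lborel. norm (?F \<tau>) \<le> norm (?G \<tau>)"
      unfolding real_norm_def by (intro AE_I2 order_trans[OF dom abs_ge_self])
  qed measurable
  then show "convolution_exists f (power_kernel b) t"
    by (simp add: convolution_exists_def set_integrable_def)
  have "(\<integral>\<tau>. norm (?F \<tau>) \<partial>lborel) \<le> (\<integral>\<tau>. ?G \<tau> \<partial>lborel)"
    using int by (intro integral_mono integrable_norm[OF F] dom) (simp add: has_bochner_integral_iff)
  also have "\<dots> = C / Gamma b * (t powr (a + b - 1) * Beta a b)"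
    using int by (rule has_bochner_integral_integral_eq)
  also have "\<dots> = C * Gamma a * norm (power_kernel (a + b) t)"
    using G by (simp add: power_kernel_def norm_divide Beta_def)
  finally show "(\<integral>\<tau>. norm (?F \<tau>) \<partial>lborel) \<le> C * Gamma a * norm (power_kernel (a + b) t)" .
qed

text \<open>
  Termwise integration of the series of \<open>M(\<beta>, \<nu>, \<mu>)\<close>. By the bound above, the absolute integrals
  of the terms are at most a constant times \<open>|\<mu>|\<^sup>k h(\<beta>k + \<nu> + a)(t)\<close>, and these are the absolute
  values of the terms of another Mittag-Leffler function, \<open>M(\<beta>, \<nu> + a, \<mu>)\<close>. So their sum is finite,
  and dominated convergence applies.
\<close>

lemma convolution_Mittag_Leffler_fun:
  assumes f [measurable]: "f \<in> borel_measurable borel"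
    and bound: "\<And>\<tau>. \<tau> \<in> {0..t} \<Longrightarrow> norm (f \<tau>) \<le> C * \<tau> powr (a - 1)"
    and a: "a > 0" and \<beta>: "\<beta> > 0" and \<nu>: "\<nu> > 0" and t: "t > 0"
  shows "convolution_exists f (Mittag_Leffler_fun \<beta> \<nu> \<mu>) t"
    and "(\<lambda>k. \<mu> ^ k * RL_integral (\<beta> * real k + \<nu>) f t)
           sums convolution f (Mittag_Leffler_fun \<beta> \<nu> \<mu>) t"
proof -
  have b: "\<beta> * real k + \<nu> > 0" for k
    using \<beta> \<nu> by (intro add_nonneg_pos) auto
  let ?K = "\<lambda>k. power_kernel (\<beta> * real k + \<nu>)"
  let ?G = "\<lambda>k \<tau>. indicator {0..t} \<tau> *\<^sub>R (f \<tau> * ?K k (t - \<tau>))"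
  define F where "F k \<tau> = \<mu> ^ k * ?G k \<tau>" for k \<tau>
  note bd = convolution_power_kernel_bound[OF f bound a b t]
  have int: "integrable lborel (F k)" for k
    using bd(1)[of k] unfolding F_def convolution_exists_def set_integrable_def
    by (intro integrable_mult_right)
  have F_eq: "F k \<tau> = indicator {0..t} \<tau> *\<^sub>R (f \<tau> * (\<mu> ^ k * ?K k (t - \<tau>)))" for k \<tau>
    by (simp add: F_def mult_ac)
  have summ: "summable (\<lambda>k. norm (F k \<tau>))" for \<tau>
  proof (cases "\<tau> \<in> {0..t}")
    case True
    then have "summable (\<lambda>k. norm (f \<tau>) * norm (\<mu> ^ k * ?K k (t - \<tau>)))"
      by (intro summable_mult Mittag_Leffler_fun_series \<beta> \<nu>) auto
    with True show ?thesis by (simp add: F_eq norm_mult)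
  qed (simp add: F_eq)
  have sum_F: "(\<Sum>k. F k \<tau>) = indicator {0..t} \<tau> *\<^sub>R (f \<tau> * Mittag_Leffler_fun \<beta> \<nu> \<mu> (t - \<tau>))" for \<tau>
  proof (cases "\<tau> \<in> {0..t}")
    case True
    then have "(\<lambda>k. f \<tau> * (\<mu> ^ k * ?K k (t - \<tau>))) sums (f \<tau> * Mittag_Leffler_fun \<beta> \<nu> \<mu> (t - \<tau>))"
      by (intro sums_mult Mittag_Leffler_fun_series \<beta> \<nu>) auto
    with True show ?thesis by (simp add: F_eq sums_iff)
  qed (simp add: F_eq)
  have summ_int: "summable (\<lambda>k. \<integral>\<tau>. norm (F k \<tau>) \<partial>lborel)"
  proof (rule summable_comparison_test)
    have "norm (\<integral>\<tau>. norm (F k \<tau>) \<partial>lborel)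
        \<le> C * Gamma a * norm (\<mu> ^ k * power_kernel (\<beta> * real k + (\<nu> + a)) t)" for k
    proof -
      have "norm (\<integral>\<tau>. norm (F k \<tau>) \<partial>lborel) = norm (\<mu> ^ k) * (\<integral>\<tau>. norm (?G k \<tau>) \<partial>lborel)"
        unfolding F_def norm_mult by (simp add: abs_mult)
      also have "\<dots> \<le> norm (\<mu> ^ k) * (C * Gamma a * norm (power_kernel (a + (\<beta> * real k + \<nu>)) t))"
        by (intro mult_left_mono bd(2)) auto
      finally show ?thesis by (simp add: norm_mult mult_ac add_ac)
    qed
    then show "\<exists>N. \<forall>k\<ge>N. norm (\<integral>\<tau>. norm (F k \<tau>) \<partial>lborel)
        \<le> C * Gamma a * norm (\<mu> ^ k * power_kernel (\<beta> * real k + (\<nu> + a)) t)"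
      by blast
    show "summable (\<lambda>k. C * Gamma a * norm (\<mu> ^ k * power_kernel (\<beta> * real k + (\<nu> + a)) t))"
      using \<nu> a t by (intro summable_mult Mittag_Leffler_fun_series \<beta>) auto
  qed
  note AE = AE_I2[of lborel, OF summ]
  show "convolution_exists f (Mittag_Leffler_fun \<beta> \<nu> \<mu>) t"
    using integrable_suminf[OF int AE summ_int]
    by (simp add: sum_F convolution_exists_def set_integrable_def)
  have "(\<integral>\<tau>. F k \<tau> \<partial>lborel) = \<mu> ^ k * RL_integral (\<beta> * real k + \<nu>) f t" for k
    unfolding RL_integral_eq_convolution(2)[OF b] convolution_def set_lebesgue_integral_def F_def
    by (rule integral_mult_right_zero)
  then show "(\<lambda>k. \<mu> ^ k * RL_integral (\<beta> * real k + \<nu>) f t)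
      sums convolution f (Mittag_Leffler_fun \<beta> \<nu> \<mu>) t"
    using sums_integral[OF int AE summ_int]
    by (simp add: sum_F convolution_def set_lebesgue_integral_def)
qed

section \<open>Fractional integrals and resolvents\<close>

text \<open>
  Formally \<open>J\<^sup>\<gamma>\<close> shifts the index of each \<open>h(\<beta>n + \<nu>)\<close> by \<open>\<gamma>\<close>. To justify it, regard \<open>J\<^sup>\<gamma>\<close> as
  convolution with \<open>h\<^sub>\<gamma>\<close> and commute the factors, so that \<open>h\<^sub>\<gamma>\<close> plays the part of \<open>f\<close> in the termwise
  integration.
\<close>

lemma RL_integral_Mittag_Leffler_fun:
  assumes \<beta>: "\<beta> > 0" and \<nu>: "\<nu> > 0" and \<gamma>: "\<gamma> \<ge> 0" and t: "t \<ge> 0"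
  shows "RL_integrable \<gamma> (Mittag_Leffler_fun \<beta> \<nu> \<mu>) t"
    and "RL_integral \<gamma> (Mittag_Leffler_fun \<beta> \<nu> \<mu>) t = Mittag_Leffler_fun \<beta> (\<nu> + \<gamma>) \<mu> t"
proof -
  let ?M = "Mittag_Leffler_fun \<beta> \<nu> \<mu>"
  have "RL_integrable \<gamma> ?M t \<and> RL_integral \<gamma> ?M t = Mittag_Leffler_fun \<beta> (\<nu> + \<gamma>) \<mu> t"
  proof -
    consider "\<gamma> = 0" | "\<gamma> > 0" "t = 0" | "\<gamma> > 0" "t > 0"
      using \<gamma> t by linarith
    then show ?thesis
    proof cases
      case 1
      then show ?thesis by (simp add: RL_integrable_def RL_integral_def)
    next
      case 2
      \<comment> \<open>The integral runs over the single point \<open>0\<close>, and both sides vanish.\<close>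
      have "(\<lambda>\<tau>. indicator {0..0} \<tau> *\<^sub>R RL_integrand \<gamma> ?M 0 \<tau>) = (\<lambda>_. 0)"
        by (auto simp: fun_eq_iff RL_integrand_def indicator_def)
      with 2 show ?thesis
        unfolding RL_integrable_def RL_integral_def set_integrable_def set_lebesgue_integral_def
        by (simp only:) (simp add: Mittag_Leffler_fun_def)
    next
      case 3
      note \<gamma> = 3(1) and t = 3(2)
      have bound: "norm (power_kernel \<gamma> \<tau>) \<le> 1 / Gamma \<gamma> * \<tau> powr (\<gamma> - 1)" for \<tau>
        using Gamma_real_pos[OF \<gamma>] by (simp add: power_kernel_def norm_divide)
      note conv = convolution_Mittag_Leffler_fun[OF borel_measurable_power_kernel bound \<gamma> \<beta> \<nu> t, of \<mu>]
      have "RL_integral (\<beta> * real k + \<nu>) (power_kernel \<gamma>) t = power_kernel (\<beta> * real k + (\<nu> + \<gamma>)) t" for k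
        using RL_integral_power_kernel(2)[OF \<gamma> _ t, of "\<beta> * real k + \<nu>"] \<beta> \<nu> by (simp add: add_ac)
      with conv(2) have "(\<lambda>k. \<mu> ^ k * power_kernel (\<beta> * real k + (\<nu> + \<gamma>)) t)
          sums convolution (power_kernel \<gamma>) ?M t" by simp
      with Mittag_Leffler_fun_series(2)[OF \<beta>, of "\<nu> + \<gamma>" t \<mu>] \<nu> \<gamma> t
      have "convolution (power_kernel \<gamma>) ?M t = Mittag_Leffler_fun \<beta> (\<nu> + \<gamma>) \<mu> t"
        by (auto intro: sums_unique2)
      with conv(1) show ?thesis
        by (simp add: RL_integral_eq_convolution[OF \<gamma>] convolution_commute[of ?M])
    qed
  qed
  then show "RL_integrable \<gamma> ?M t" "RL_integral \<gamma> ?M t = Mittag_Leffler_fun \<beta> (\<nu> + \<gamma>) \<mu> t"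
    by auto
qed

text \<open>
  Multiplication by \<open>\<mu>\<close> turns the kernel series of \<open>M(\<beta>, \<nu> + \<beta>, \<mu>)\<close> into the one of \<open>M(\<beta>, \<nu>, \<mu>)\<close>
  without its first term.
\<close>

lemma Mittag_Leffler_fun_recurrence:
  assumes \<beta>: "\<beta> > 0" and \<nu>: "\<nu> > 0" and t: "t \<ge> 0"
  shows "Mittag_Leffler_fun \<beta> \<nu> \<mu> t - \<mu> * Mittag_Leffler_fun \<beta> (\<nu> + \<beta>) \<mu> t = power_kernel \<nu> t"
proof -
  let ?a = "\<lambda>n. \<mu> ^ n * power_kernel (\<beta> * real n + \<nu>) t"
  have "(\<lambda>n. \<mu> * (\<mu> ^ n * power_kernel (\<beta> * real n + (\<nu> + \<beta>)) t))
      sums (\<mu> * Mittag_Leffler_fun \<beta> (\<nu> + \<beta>) \<mu> t)"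
    using \<beta> \<nu> t by (intro sums_mult Mittag_Leffler_fun_series) auto
  then have "(\<lambda>n. ?a (Suc n)) sums (\<mu> * Mittag_Leffler_fun \<beta> (\<nu> + \<beta>) \<mu> t)"
    by (simp add: algebra_simps)
  then have "?a sums (\<mu> * Mittag_Leffler_fun \<beta> (\<nu> + \<beta>) \<mu> t + ?a 0)"
    by (rule sums_Suc[of ?a])
  from sums_unique2[OF this Mittag_Leffler_fun_series(2)[OF \<beta> \<nu> t]] show ?thesis
    by (simp add: algebra_simps)
qed

lemma RL_integral_cong:
  assumes "\<And>s. s \<in> {0..t} \<Longrightarrow> f s = g s" and "t \<ge> 0"
  shows "RL_integrable \<gamma> f t \<longleftrightarrow> RL_integrable \<gamma> g t" and "RL_integral \<gamma> f t = RL_integral \<gamma> g t"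
proof -
  have "(\<lambda>s. indicator {0..t} s *\<^sub>R RL_integrand \<gamma> f t s)
      = (\<lambda>s. indicator {0..t} s *\<^sub>R RL_integrand \<gamma> g t s)"
    using assms(1) by (auto simp: fun_eq_iff RL_integrand_def indicator_def)
  moreover have "f t = g t" using assms by simp
  ultimately show "RL_integrable \<gamma> f t \<longleftrightarrow> RL_integrable \<gamma> g t"
    and "RL_integral \<gamma> f t = RL_integral \<gamma> g t"
    unfolding RL_integrable_def RL_integral_def set_integrable_def set_lebesgue_integral_def
    by (simp_all only:)
qed

lemma RL_resolvent_cong:
  assumes "\<And>s. s \<in> {0..t} \<Longrightarrow> f s = g s" and "t \<ge> 0"
  shows "RL_resolvent_exists \<mu> \<beta> f t \<longleftrightarrow> RL_resolvent_exists \<mu> \<beta> g t"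
    and "RL_resolvent \<mu> \<beta> f t = RL_resolvent \<mu> \<beta> g t"
proof -
  have cong: "RL_integrable \<gamma> f t \<longleftrightarrow> RL_integrable \<gamma> g t"
    "RL_integral \<gamma> f t = RL_integral \<gamma> g t" for \<gamma>
    by (rule RL_integral_cong, use assms in auto)+
  show "RL_resolvent_exists \<mu> \<beta> f t \<longleftrightarrow> RL_resolvent_exists \<mu> \<beta> g t"
    unfolding RL_resolvent_exists_def cong ..
  show "RL_resolvent \<mu> \<beta> f t = RL_resolvent \<mu> \<beta> g t"
    unfolding RL_resolvent_def cong ..
qed

lemma RL_resolventI:
  assumes "\<And>k. RL_integrable (real k * \<beta>) f t"
    and "(\<lambda>k. \<mu> ^ k * RL_integral (real k * \<beta>) f t) sums y"
  shows "RL_resolvent_exists \<mu> \<beta> f t \<and> RL_resolvent \<mu> \<beta> f t = y"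
  using assms by (auto simp: RL_resolvent_exists_def RL_resolvent_def sums_iff)

text \<open>
  Since \<open>J(k\<beta>) h\<^sub>\<nu> = h(\<beta>k + \<nu>)\<close>, the Neumann series is the kernel series of \<open>M(\<beta>, \<nu>, \<mu>)\<close>.
\<close>

lemma RL_resolvent_power_kernel:
  assumes \<beta>: "\<beta> > 0" and \<nu>: "\<nu> > 0" and t: "t > 0"
  shows "RL_resolvent_exists \<mu> \<beta> (power_kernel \<nu>) t"
    and "RL_resolvent \<mu> \<beta> (power_kernel \<nu>) t = Mittag_Leffler_fun \<beta> \<nu> \<mu> t"
proof -
  have "RL_resolvent_exists \<mu> \<beta> (power_kernel \<nu>) t \<and>
      RL_resolvent \<mu> \<beta> (power_kernel \<nu>) t = Mittag_Leffler_fun \<beta> \<nu> \<mu> t"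
  proof (rule RL_resolventI)
    show "RL_integrable (real k * \<beta>) (power_kernel \<nu>) t" for k
      using \<beta> by (intro RL_integral_power_kernel \<nu> t) auto
    show "(\<lambda>k. \<mu> ^ k * RL_integral (real k * \<beta>) (power_kernel \<nu>) t)
        sums Mittag_Leffler_fun \<beta> \<nu> \<mu> t"
      using Mittag_Leffler_fun_series(2)[OF \<beta> \<nu>, of t \<mu>] \<beta> t
      by (simp add: RL_integral_power_kernel(2)[OF \<nu> _ t] algebra_simps)
  qed
  then show "RL_resolvent_exists \<mu> \<beta> (power_kernel \<nu>) t"
    "RL_resolvent \<mu> \<beta> (power_kernel \<nu>) t = Mittag_Leffler_fun \<beta> \<nu> \<mu> t" by auto
qed

text \<open>
  The bracket in (i). The point \<open>s = 0\<close> is included because it lies in the range of integration of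
  the Neumann series.
\<close>

lemma Mittag_Leffler_fun_minus_RL_integral:
  assumes \<beta>: "\<beta> > 0" and \<nu>: "\<nu> > 0" and s: "s \<ge> 0"
  shows "Mittag_Leffler_fun \<beta> \<nu> \<mu> s - \<mu> * RL_integral \<nu> (Mittag_Leffler_fun \<beta> \<beta> \<mu>) s
           = power_kernel \<nu> s"
  using RL_integral_Mittag_Leffler_fun(2)[OF \<beta> \<beta> _ s, of \<nu> \<mu>] \<nu>
    Mittag_Leffler_fun_recurrence[OF \<beta> \<nu> s, of \<mu>] by (simp add: add.commute)

text \<open>
  Relation (ii): the semigroup law \<open>J(k\<beta>) J(\<beta>) f = J(k\<beta> + \<beta>) f\<close> follows from the shift rule,
  since both sides equal \<open>M(\<alpha>, \<nu> + \<beta> + k\<beta>, \<rho>)\<close>. The Neumann series thus becomes the termwise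
  integrated convolution.
\<close>

lemma RL_resolvent_RL_integral_Mittag_Leffler_fun:
  fixes \<alpha> \<beta> \<nu> t :: real and \<rho> \<mu> :: complex
  assumes \<alpha>: "\<alpha> > 0" and \<beta>: "\<beta> > 0" and \<nu>: "\<nu> > 0" and t: "t > 0"
  defines "f \<equiv> Mittag_Leffler_fun \<alpha> \<nu> \<rho>"
    and "g \<equiv> Mittag_Leffler_fun \<beta> \<beta> \<mu>"
  shows "convolution_exists f g t"
    and "RL_resolvent_exists \<mu> \<beta> (RL_integral \<beta> f) t"
    and "RL_resolvent \<mu> \<beta> (RL_integral \<beta> f) t = convolution f g t"
proof -
  have f [measurable]: "f \<in> borel_measurable borel"
    unfolding f_def by measurable
  obtain C where C: "\<And>\<tau>. \<tau> \<in> {0..t} \<Longrightarrow> norm (f \<tau>) \<le> C * \<tau> powr (\<nu> - 1)"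
    using Mittag_Leffler_fun_bound[OF \<alpha> \<nu>, of t \<rho>] unfolding f_def by blast
  note conv = convolution_Mittag_Leffler_fun[OF f C \<nu> \<beta> \<beta> t, of \<mu>, folded g_def]
  let ?h = "Mittag_Leffler_fun \<alpha> (\<nu> + \<beta>) \<rho>"
  have h: "RL_integral \<beta> f s = ?h s" if "s \<in> {0..t}" for s
    unfolding f_def using that \<beta> by (intro RL_integral_Mittag_Leffler_fun \<alpha> \<nu>) auto
  have res: "RL_resolvent_exists \<mu> \<beta> ?h t \<and> RL_resolvent \<mu> \<beta> ?h t = convolution f g t"
  proof (rule RL_resolventI)
    show "RL_integrable (real k * \<beta>) ?h t" for k
      using \<alpha> \<beta> \<nu> t by (intro RL_integral_Mittag_Leffler_fun) auto
    have "RL_integral (real k * \<beta>) ?h t = RL_integral (\<beta> * real k + \<beta>) f t" for k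
      using \<alpha> \<beta> \<nu> t by (simp add: f_def RL_integral_Mittag_Leffler_fun algebra_simps)
    then show "(\<lambda>k. \<mu> ^ k * RL_integral (real k * \<beta>) ?h t) sums convolution f g t"
      using conv(2) by simp
  qed
  have t0: "t \<ge> 0" using t by simp
  show "convolution_exists f g t" by (rule conv(1))
  show "RL_resolvent_exists \<mu> \<beta> (RL_integral \<beta> f) t"
    using RL_resolvent_cong(1)[of t "RL_integral \<beta> f" ?h, OF h t0] res by blast
  show "RL_resolvent \<mu> \<beta> (RL_integral \<beta> f) t = convolution f g t"
    using RL_resolvent_cong(2)[of t "RL_integral \<beta> f" ?h, OF h t0] res by simp
qed

theorem lemma2p2:
  fixes \<beta>\<^sub>1 \<beta>\<^sub>2 \<nu> :: real and \<mu>\<^sub>1 \<mu>\<^sub>2 :: complex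
  assumes "\<beta>\<^sub>1 > 0" and "\<beta>\<^sub>2 > 0" and "\<nu> > 0"
  shows
    "(\<forall>t>0.
        RL_integrable \<nu> (Mittag_Leffler_fun \<beta>\<^sub>1 \<beta>\<^sub>1 \<mu>\<^sub>1) t \<and>
        RL_resolvent_exists \<mu>\<^sub>2 \<beta>\<^sub>2
          (\<lambda>s. Mittag_Leffler_fun \<beta>\<^sub>1 \<nu> \<mu>\<^sub>1 s
                - \<mu>\<^sub>1 * RL_integral \<nu> (Mittag_Leffler_fun \<beta>\<^sub>1 \<beta>\<^sub>1 \<mu>\<^sub>1) s) t \<and>
        RL_resolvent \<mu>\<^sub>2 \<beta>\<^sub>2
          (\<lambda>s. Mittag_Leffler_fun \<beta>\<^sub>1 \<nu> \<mu>\<^sub>1 s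
                - \<mu>\<^sub>1 * RL_integral \<nu> (Mittag_Leffler_fun \<beta>\<^sub>1 \<beta>\<^sub>1 \<mu>\<^sub>1) s) t
        = Mittag_Leffler_fun \<beta>\<^sub>2 \<nu> \<mu>\<^sub>2 t) \<and>
     (\<forall>t>0.
        RL_integrable \<beta>\<^sub>2 (Mittag_Leffler_fun \<beta>\<^sub>1 \<nu> \<mu>\<^sub>1) t \<and>
        RL_resolvent_exists \<mu>\<^sub>2 \<beta>\<^sub>2
          (RL_integral \<beta>\<^sub>2 (Mittag_Leffler_fun \<beta>\<^sub>1 \<nu> \<mu>\<^sub>1)) t \<and>
        convolution_exists (Mittag_Leffler_fun \<beta>\<^sub>1 \<nu> \<mu>\<^sub>1) (Mittag_Leffler_fun \<beta>\<^sub>2 \<beta>\<^sub>2 \<mu>\<^sub>2) t \<and>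
        RL_resolvent \<mu>\<^sub>2 \<beta>\<^sub>2
          (RL_integral \<beta>\<^sub>2 (Mittag_Leffler_fun \<beta>\<^sub>1 \<nu> \<mu>\<^sub>1)) t
        = convolution (Mittag_Leffler_fun \<beta>\<^sub>1 \<nu> \<mu>\<^sub>1) (Mittag_Leffler_fun \<beta>\<^sub>2 \<beta>\<^sub>2 \<mu>\<^sub>2) t)"
proof (intro conjI allI impI)
  fix t :: real assume t: "t > 0"
  let ?g = "\<lambda>s. Mittag_Leffler_fun \<beta>\<^sub>1 \<nu> \<mu>\<^sub>1 s - \<mu>\<^sub>1 * RL_integral \<nu> (Mittag_Leffler_fun \<beta>\<^sub>1 \<beta>\<^sub>1 \<mu>\<^sub>1) s"
  have g: "?g s = power_kernel \<nu> s" if "s \<in> {0..t}" for s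
    using that assms by (intro Mittag_Leffler_fun_minus_RL_integral) auto
  have cong: "RL_resolvent_exists \<mu>\<^sub>2 \<beta>\<^sub>2 ?g t \<longleftrightarrow> RL_resolvent_exists \<mu>\<^sub>2 \<beta>\<^sub>2 (power_kernel \<nu>) t"
    "RL_resolvent \<mu>\<^sub>2 \<beta>\<^sub>2 ?g t = RL_resolvent \<mu>\<^sub>2 \<beta>\<^sub>2 (power_kernel \<nu>) t"
    by (rule RL_resolvent_cong, rule g, use t in auto)+
  show "RL_integrable \<nu> (Mittag_Leffler_fun \<beta>\<^sub>1 \<beta>\<^sub>1 \<mu>\<^sub>1) t"
    using assms t by (intro RL_integral_Mittag_Leffler_fun) auto
  show "RL_resolvent_exists \<mu>\<^sub>2 \<beta>\<^sub>2 ?g t"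
    using RL_resolvent_power_kernel(1)[OF assms(2,3) t, of \<mu>\<^sub>2] unfolding cong .
  show "RL_resolvent \<mu>\<^sub>2 \<beta>\<^sub>2 ?g t = Mittag_Leffler_fun \<beta>\<^sub>2 \<nu> \<mu>\<^sub>2 t"
    using RL_resolvent_power_kernel(2)[OF assms(2,3) t, of \<mu>\<^sub>2] unfolding cong .
next
  fix t :: real assume t: "t > 0"
  note ii = RL_resolvent_RL_integral_Mittag_Leffler_fun[OF assms t]
  let ?f = "Mittag_Leffler_fun \<beta>\<^sub>1 \<nu> \<mu>\<^sub>1" and ?k = "Mittag_Leffler_fun \<beta>\<^sub>2 \<beta>\<^sub>2 \<mu>\<^sub>2"
  show "RL_integrable \<beta>\<^sub>2 ?f t"
    using assms t by (intro RL_integral_Mittag_Leffler_fun) auto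
  show "RL_resolvent_exists \<mu>\<^sub>2 \<beta>\<^sub>2 (RL_integral \<beta>\<^sub>2 ?f) t" by (rule ii(2))
  show "convolution_exists ?f ?k t" by (rule ii(1))
  show "RL_resolvent \<mu>\<^sub>2 \<beta>\<^sub>2 (RL_integral \<beta>\<^sub>2 ?f) t = convolution ?f ?k t" by (rule ii(3))
qed

end
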